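(* Let $n=p_1p_2\cdots p_t\ge2$ be squarefree, where $p_1,\ldots,p_t$ are distinct primes. For any given $k\in\mathbb{N}$, the roots of $\Phi_n(z^k)$ are the nonzero components of the Kronecker product $$\vec\zeta_k\otimes(\vec\zeta_{p_1}^{\,*})^{\frac1k}\otimes\cdots\otimes(\vec\zeta_{p_t}^{\,*})^{\frac1k},$$ where $\vec\zeta_{p_j}^{\,*}:=(0,\zeta_{p_j},\zeta_{p_j}^2,\ldots,\zeta_{p_j}^{p_j-1})$.
   Context: $\mathbb{N}=\{1,2,\ldots\}$. $\Phi_n$ is the $n$th cyclotomic polynomial, $\zeta_n:=e^{2\pi i/n}$, and $\vec\zeta_k:=(1,\zeta_k,\ldots,\zeta_k^{k-1})\in\mathbb{C}^k$. The Kronecker product of $\vec x=(x_1,\ldots,x_a)\in\mathbb{C}^a$ and $\vec y=(y_1,\ldots,y_b)\in\mathbb{C}^b$ is $\vec x\otimes\vec y=(x_1\vec y,\ldots,x_a\vec y)\in\mathbb{C}^{ab}$, where $x_j\vec y=(x_jy_1,\ldots,x_jy_b)$. For $\vec\xi=(\xi_1,\ldots,\xi_r)\in\mathbb{C}^r$, $\vec\xi^{\,1/k}:=(\xi_1^{1/k},\ldots,\xi_r^{1/k})$, where for $y\in\mathbb{C}$, $y^{1/k}$ is the principal $k$th root $y^{1/k}=|y|^{1/k}e^{i\,\mathrm{Arg}(y)/k}$ with $-\pi<\mathrm{Arg}(y)\le\pi$ (and $0^{1/k}=0$). *)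

theory Defs
  imports
    "HOL-Analysis.Analysis"
    "HOL-Computational_Algebra.Computational_Algebra"
begin

definition zeta :: "nat \<Rightarrow> complex" where
  "zeta n = exp (2 * complex_of_real pi * \<i> / of_nat n)"

definition cyclotomic :: "nat \<Rightarrow> complex poly" where
  "cyclotomic n = (\<Prod>j | j \<in> {1..n} \<and> coprime j n. [:- (zeta n ^ j), 1:])"

text \<open>Vectors of arbitrary finite dimension are lists of their components.\<close>

definition zeta_vec :: "nat \<Rightarrow> complex list" where
  "zeta_vec k = map (\<lambda>j. zeta k ^ j) [0..<k]"

definition zeta_star :: "nat \<Rightarrow> complex list" where
  "zeta_star p = 0 # map (\<lambda>j. zeta p ^ j) [1..<p]"

definition kronecker :: "complex list \<Rightarrow> complex list \<Rightarrow> complex list" where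
  "kronecker xs ys = concat (map (\<lambda>x. map (\<lambda>y. x * y) ys) xs)"

text \<open>The principal \<open>k\<close>th root: \<^const>\<open>Arg\<close> takes values in \<open>(-\<pi>, \<pi>]\<close>, and since
  \<open>0 powr a = 0\<close> the root of \<open>0\<close> is \<open>0\<close>.\<close>

definition principal_root :: "nat \<Rightarrow> complex \<Rightarrow> complex" where
  "principal_root k y =
     complex_of_real (cmod y powr (1 / real k)) * exp (\<i> * complex_of_real (Arg y) / of_nat k)"

definition root_vec :: "nat \<Rightarrow> complex list \<Rightarrow> complex list" where
  "root_vec k xs = map (principal_root k) xs"

end

theory Submission
  imports Defs "HOL-Number_Theory.Cong"
begin

text \<open>Roots of unity multiply along the Chinese remainder theorem: for coprime \<open>m\<close> and \<open>p\<close> the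
  product of \<open>zeta m ^ a\<close> and \<open>zeta p ^ b\<close> is \<open>zeta (m * p) ^ (a * p + b * m)\<close>, every residue modulo
  \<open>m * p\<close> is such an exponent, and it is a unit exactly when \<open>a\<close> and \<open>b\<close> are units modulo \<open>m\<close> and
  \<open>p\<close>. Any \<open>k\<close>th root of a product differs from the product of the principal roots by a \<open>k\<close>th root
  of unity, which the factor \<open>zeta_vec k\<close> supplies.\<close>

lemma zeta_power_cis: "zeta n ^ j = cis (2 * pi * real j / real n)"
proof -
  have "zeta n = cis (2 * pi / real n)"
    by (simp add: zeta_def cis_conv_exp mult_ac)
  then show ?thesis
    by (simp add: Complex.DeMoivre mult_ac)
qed

lemma zeta_nonzero [simp]: "zeta n \<noteq> 0"
  by (simp add: zeta_def)

lemma zeta_power_self [simp]: "n > 0 \<Longrightarrow> zeta n ^ n = 1"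
  by (simp add: zeta_power_cis)

lemma zeta_power_cong:
  assumes "n > 0" "[i = j] (mod n)"
  shows "zeta n ^ i = zeta n ^ j"
proof -
  have "zeta n ^ i = zeta n ^ (i mod n)" for i
  proof -
    have "zeta n ^ i = zeta n ^ (n * (i div n) + i mod n)" by simp
    also have "\<dots> = (zeta n ^ n) ^ (i div n) * zeta n ^ (i mod n)"
      by (simp only: power_add power_mult)
    finally show ?thesis using assms(1) by simp
  qed
  then show ?thesis using assms(2) by (metis cong_def)
qed

lemma zeta_mult_power:
  assumes "p > 0"
  shows "zeta (m * p) ^ (p * i) = zeta m ^ i"
  using assms by (simp add: zeta_power_cis mult.assoc)

lemma zeta_power_mult_zeta_power:
  assumes "m > 0" "p > 0"
  shows "zeta m ^ a * zeta p ^ b = zeta (m * p) ^ (a * p + b * m)"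
  using zeta_mult_power[OF assms(2), of m a] zeta_mult_power[OF assms(1), of p b]
  by (simp add: power_add mult.commute)

lemma set_zeta_vec:
  assumes "k > 0"
  shows "set (zeta_vec k) = {z. z ^ k = 1}"
  using bij_betw_imp_surj_on[OF Complex.bij_betw_roots_unity[OF assms]]
  by (simp add: zeta_vec_def zeta_power_cis lessThan_atLeast0)

lemma set_kronecker: "set (kronecker xs ys) = {x * y | x y. x \<in> set xs \<and> y \<in> set ys}"
  by (auto simp: kronecker_def)

lemma principal_root_power:
  assumes "k > 0"
  shows "principal_root k y ^ k = y"
proof (cases "y = 0")
  case False
  then have "(cmod y powr (1 / real k)) ^ k = cmod y"
    using assms by (simp add: powr_power)
  moreover have "exp (\<i> * complex_of_real (Arg y) / of_nat k) ^ k = exp (\<i> * complex_of_real (Arg y))"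
    using assms by (simp flip: exp_of_nat_mult)
  ultimately show ?thesis
    using False Arg_eq[of y] by (simp add: principal_root_def power_mult_distrib flip: of_real_power)
qed (use assms in \<open>simp add: principal_root_def\<close>)

text \<open>Coprimality to \<open>n\<close> and the value of \<open>zeta n ^ j\<close> depend only
  on \<open>j\<close> modulo \<open>n\<close>. Freeing \<open>j\<close> from the range
  \<open>{1..n}\<close> lets exponents built from residues be used unreduced.\<close>

lemma poly_cyclotomic_eq_0_iff:
  assumes "n > 0"
  shows "poly (cyclotomic n) w = 0 \<longleftrightarrow> (\<exists>j. coprime j n \<and> w = zeta n ^ j)"
proof -
  have "poly (cyclotomic n) w = 0 \<longleftrightarrow> (\<exists>j\<in>{1..n}. coprime j n \<and> w = zeta n ^ j)"
    unfolding cyclotomic_def by (auto simp: poly_prod)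
  moreover have "\<exists>i\<in>{1..n}. coprime i n \<and> zeta n ^ j = zeta n ^ i" if "coprime j n" for j
  \<comment> \<open>The residue 0 lies outside \<open>{1..n}\<close>. It is coprime to
    \<open>n\<close> only for \<open>n = 1\<close>, where the representative is 1 instead.\<close>
  proof (cases "n = 1")
    case True
    then show ?thesis using zeta_power_cong[of 1 j 1] by simp
  next
    case False
    then have "j mod n \<noteq> 0"
      using that assms by (metis coprime_0_left_iff coprime_mod_left_iff less_irrefl nat_dvd_1_iff_1)
    moreover have "j mod n < n" using assms by simp
    moreover have "coprime (j mod n) n" using that assms by simp
    moreover have "zeta n ^ j = zeta n ^ (j mod n)" using assms by (intro zeta_power_cong) auto
    ultimately show ?thesis by (intro bexI[of _ "j mod n"]) auto
  qed
  ultimately show ?thesis by auto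
qed

text \<open>Multiplying \<open>j\<close> by an inverse of \<open>p\<close> modulo \<open>m\<close>
  gives \<open>a\<close>, and by an inverse of \<open>m\<close> modulo \<open>p\<close> gives
  \<open>b\<close>. The latter is reduced so that it can index an entry of
  \<open>zeta_star p\<close>.\<close>

lemma cong_combination:
  fixes m p :: nat
  assumes "coprime m p" "m > 0" "p > 0"
  obtains a b where "b < p" "[a * p + b * m = j] (mod (m * p))"
proof -
  obtain x where "[p * x = 1] (mod m)"
    using cong_solve_coprime_nat[of p m] assms by (auto simp: coprime_commute)
  then have x: "[(x * j) * p = j] (mod m)"
    using cong_scalar_right[of "p * x" 1 m j] by (simp add: mult_ac)
  obtain y where "[m * y = 1] (mod p)"
    using cong_solve_coprime_nat[of m p] assms by auto
  then have "[(y * j) * m = j] (mod p)"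
    using cong_scalar_right[of "m * y" 1 p j] by (simp add: mult_ac)
  then have y: "[(y * j mod p) * m = j] (mod p)"
    by (simp add: cong_def mod_mult_left_eq)
  have "[x * j * p + (y * j mod p) * m = j] (mod m)"
    using x by (simp add: cong_def)
  moreover have "[x * j * p + (y * j mod p) * m = j] (mod p)"
    using y by (simp add: cong_def)
  ultimately have "[x * j * p + (y * j mod p) * m = j] (mod (m * p))"
    using assms(1) by (rule coprime_cong_mult_nat)
  then show ?thesis using assms(3) by (intro that[of "y * j mod p"]) auto
qed

lemma cyclotomic_mult_prime_root_iff:
  assumes "m > 0" "prime p" "coprime m p"
  shows "poly (cyclotomic (m * p)) w = 0 \<longleftrightarrow>
    (\<exists>u b. poly (cyclotomic m) u = 0 \<and> b \<in> {1..<p} \<and> w = u * zeta p ^ b)"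
proof -
  have p: "p > 0" using assms(2) by (simp add: prime_gt_0_nat)
  \<comment> \<open>Modulo \<open>m\<close> the sum is \<open>a * p\<close> with \<open>p\<close> a
    unit; modulo \<open>p\<close> it is \<open>b * m\<close> with \<open>m\<close> a unit.\<close>
  have unit: "coprime (a * p + b * m) (m * p) \<longleftrightarrow> coprime a m \<and> coprime b p" for a b
  proof -
    have "coprime (a * p + b * m) m \<longleftrightarrow> coprime a m"
      using assms(3) by (metis coprime_commute coprime_iff_gcd_eq_1 coprime_mult_left_iff gcd_add_mult
          add.commute mult.commute)
    moreover have "coprime (a * p + b * m) p \<longleftrightarrow> coprime b p"
      using assms(3) by (metis coprime_commute coprime_iff_gcd_eq_1 coprime_mult_left_iff gcd_add_mult
          add.commute mult.commute)
    ultimately show ?thesis by simp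
  qed
  have cop: "coprime b p \<longleftrightarrow> b \<noteq> 0" if "b < p" for b
    using that assms(2)
    by (metis coprime_0_left_iff coprime_commute dvd_imp_le gr0I not_le not_prime_unit prime_imp_coprime)
  show ?thesis
  proof
    assume "poly (cyclotomic (m * p)) w = 0"
    then obtain j where j: "coprime j (m * p)" "w = zeta (m * p) ^ j"
      using assms(1) p by (auto simp: poly_cyclotomic_eq_0_iff)
    obtain a b where ab: "b < p" "[a * p + b * m = j] (mod (m * p))"
      using cong_combination[OF assms(3,1) p] by blast
    have "w = zeta m ^ a * zeta p ^ b"
      using j(2) zeta_power_cong[OF _ ab(2)] assms(1) p by (simp add: zeta_power_mult_zeta_power)
    moreover have "coprime a m \<and> coprime b p"
      using j(1) ab(2) unit cong_imp_coprime cong_sym by blast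
    moreover from this have "b \<in> {1..<p}"
      using ab(1) cop[OF ab(1)] by auto
    ultimately show "\<exists>u b. poly (cyclotomic m) u = 0 \<and> b \<in> {1..<p} \<and> w = u * zeta p ^ b"
      using poly_cyclotomic_eq_0_iff[OF assms(1)] by blast
  next
    assume "\<exists>u b. poly (cyclotomic m) u = 0 \<and> b \<in> {1..<p} \<and> w = u * zeta p ^ b"
    then obtain a b where "coprime a m" "b \<in> {1..<p}" "w = zeta m ^ a * zeta p ^ b"
      using assms(1) by (auto simp: poly_cyclotomic_eq_0_iff)
    then show "poly (cyclotomic (m * p)) w = 0"
      using assms(1) p unit cop by (auto simp: poly_cyclotomic_eq_0_iff zeta_power_mult_zeta_power)
  qed
qed

text \<open>The nonzero entries of \<open>xs\<close> form the full preimage of \<open>A\<close>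
  under the \<open>k\<close>th power, hence are closed under multiplication by \<open>k\<close>th
  roots of unity. The choice of the branch of the root is therefore harmless. Assumption and
  conclusion have the same shape, which makes this an induction step.\<close>

lemma nonzero_kronecker_root_vec:
  assumes "k > 0"
    and xs: "\<And>z. z \<noteq> 0 \<and> z \<in> set xs \<longleftrightarrow> z ^ k \<in> A"
  shows "z \<noteq> 0 \<and> z \<in> set (kronecker xs (root_vec k ys)) \<longleftrightarrow>
    (\<exists>u y. u \<in> A \<and> y \<in> set ys \<and> y \<noteq> 0 \<and> z ^ k = u * y)" (is "?L \<longleftrightarrow> ?R")
proof
  assume ?L
  then obtain x y where *: "x \<in> set xs" "y \<in> set ys" "z = x * principal_root k y" "z \<noteq> 0"
    by (auto simp: set_kronecker root_vec_def)
  then have "x ^ k \<in> A" using xs[of x] by auto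
  moreover have "y \<noteq> 0"
    using * assms(1) by (auto simp: principal_root_def)
  moreover have "z ^ k = x ^ k * y"
    using * assms(1) by (simp add: power_mult_distrib principal_root_power)
  ultimately show ?R using *(2) by blast
next
  assume ?R
  then obtain u y where *: "u \<in> A" "y \<in> set ys" "y \<noteq> 0" "z ^ k = u * y" by blast
  \<comment> \<open>The only possible cofactor of the root of \<open>y\<close>; its
    \<open>k\<close>th power is \<open>u\<close>, so the preimage property puts it in
    \<open>xs\<close>.\<close>
  define x where "x = z / principal_root k y"
  have root: "principal_root k y \<noteq> 0"
    using * principal_root_power[OF assms(1), of y] assms(1) by (auto simp: power_0_left)
  have "x ^ k = u"
    using * assms(1) by (simp add: x_def power_divide principal_root_power)
  then have "x \<noteq> 0 \<and> x \<in> set xs" using xs[of x] *(1) by simp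
  moreover have "z = x * principal_root k y" using root by (simp add: x_def)
  ultimately show ?L
    using * root by (auto simp: set_kronecker root_vec_def)
qed

text \<open>The induction appends primes at the end, because \<open>foldl\<close> applies the last
  Kronecker factor outermost. The point \<open>z\<close> stays arbitrary: the hypothesis is applied
  to the left cofactor of \<open>z\<close>, not to \<open>z\<close> itself.\<close>

lemma nonzero_foldl_kronecker:
  assumes "k > 0" "distinct ps" "\<forall>p\<in>set ps. prime p"
  shows "z \<noteq> 0 \<and> z \<in> set (foldl kronecker (zeta_vec k) (map (\<lambda>p. root_vec k (zeta_star p)) ps))
    \<longleftrightarrow> z ^ k \<in> {w. poly (cyclotomic (prod_list ps)) w = 0}"
  using assms(2,3)
proof (induction ps arbitrary: z rule: rev_induct)
  case Nil
  \<comment> \<open>The empty product is 1 and the only root of \<open>cyclotomic 1\<close> is 1, so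
    both sides say \<open>z ^ k = 1\<close>.\<close>
  show ?case
    using assms(1) zeta_power_self[of 1]
    by (auto simp: set_zeta_vec poly_cyclotomic_eq_0_iff power_0_left)
next
  case (snoc p ps)
  have nonzero: "y \<in> set (zeta_star p) \<and> y \<noteq> 0 \<longleftrightarrow> y \<in> (\<lambda>b. zeta p ^ b) ` {1..<p}" for y
    by (auto simp: zeta_star_def)
  \<comment> \<open>Replaces the exponent \<open>b\<close> by the entry \<open>zeta p ^ b\<close>;
    the leading 0 of \<open>zeta_star p\<close> stands in place of the excluded exponent 0.\<close>
  have star: "(\<exists>b. b \<in> {1..<p} \<and> w = u * zeta p ^ b) \<longleftrightarrow>
      (\<exists>y. y \<in> set (zeta_star p) \<and> y \<noteq> 0 \<and> w = u * y)" for u w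
    unfolding conj_assoc[symmetric] nonzero by blast
  have IH: "z \<noteq> 0 \<and> z \<in> set (foldl kronecker (zeta_vec k) (map (\<lambda>p. root_vec k (zeta_star p)) ps))
    \<longleftrightarrow> z ^ k \<in> {w. poly (cyclotomic (prod_list ps)) w = 0}" for z
    using snoc.prems by (intro snoc.IH) auto
  have "q > 0" if "q \<in> set ps" for q
    using that snoc.prems(2) by (intro prime_gt_0_nat) auto
  then have "0 \<notin> set ps"
    by (meson less_irrefl)
  then have pos: "prod_list ps > 0"
    by (intro Nat.gr0I) (simp add: prod_list_zero_iff)
  have "coprime q p" if "q \<in> set ps" for q
    using that snoc.prems by (intro primes_coprime) auto
  then have "coprime (prod_list ps) p"
    by (intro prod_list_coprime_left) auto
  then have "poly (cyclotomic (prod_list (ps @ [p]))) (z ^ k) = 0 \<longleftrightarrow>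
      (\<exists>u b. poly (cyclotomic (prod_list ps)) u = 0 \<and> b \<in> {1..<p} \<and> z ^ k = u * zeta p ^ b)"
    using snoc.prems pos by (simp add: cyclotomic_mult_prime_root_iff)
  also have "\<dots> \<longleftrightarrow> (\<exists>u y. u \<in> {w. poly (cyclotomic (prod_list ps)) w = 0} \<and>
      y \<in> set (zeta_star p) \<and> y \<noteq> 0 \<and> z ^ k = u * y)"
    by (simp only: ex_simps mem_Collect_eq star)
  also note nonzero_kronecker_root_vec[OF assms(1) IH, of z "zeta_star p", symmetric]
  finally show ?case
    by (simp only: map_append list.map foldl_append foldl.simps mem_Collect_eq)
qed

theorem proposition1p9:
  fixes n k :: nat and ps :: "nat list"
  assumes "n \<ge> 2" and "squarefree n"
    and "n = prod_list ps" and "distinct ps" and "\<forall>p\<in>set ps. prime p"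
    and "k \<ge> 1"
  shows "{z :: complex. poly (cyclotomic n) (z ^ k) = 0} =
    {z \<in> set (foldl kronecker (zeta_vec k) (map (\<lambda>p. root_vec k (zeta_star p)) ps)). z \<noteq> 0}"
  using nonzero_foldl_kronecker[of k ps] assms by auto

end
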